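(* Let $a,b\ge 3$ and $k\ge 2$ be integers and let $G=CB(k,a,b)$ be the cycle barbell. Then \begin{align*} \mathscr{K}_v(G)=\frac{1}{a+b+k-1}\Bigg[&\frac{(a+1)(a-1)}{6}\bigl(a+2(b+k-1)\bigr)+\frac{(b+1)(b-1)}{6}\bigl(b+2(a+k-1)\bigr)\\ &+(a+b)(k-1)^2+\frac{(k-1)(2k^2-4k+3)}{6}+2ab(k-1)\Bigg]. \end{align*}
   Context: The cycle barbell $CB(k,a,b)$ is the graph obtained from a cycle $C_a$, a path $P_k$ on $k$ vertices and a cycle $C_b$ by identifying one endpoint of the path with a vertex of $C_a$ and the other endpoint with a vertex of $C_b$. It has $a+b+k-2$ vertices and $a+b+k-1$ edges. The vertex Kemeny's constant $\mathscr{K}_v(G)$ is Kemeny's constant of the simple random walk on the vertices of $G$ (transition matrix $D^{-1}A$): if this matrix has eigenvalues $1=\rho_1,\rho_2,\dots,\rho_n$, then $\mathscr{K}_v(G)=\sum_{i=2}^n\frac{1}{1-\rho_i}$; equivalently $\sum_{j\ne i}\pi_j m_{ij}$ with $\pi$ the stationary distribution and $m_{ij}$ mean first passage times. *)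

theory Defs
  imports "Jordan_Normal_Form.Spectral_Radius"
begin

text \<open>A (simple) graph on the vertex set {0..<n} is given by a symmetric irreflexive
  adjacency predicate.  Degree, random-walk transition matrix D^{-1}A, and
  vertex Kemeny's constant (sum over the eigenvalues rho_2..rho_n, counted with
  algebraic multiplicity, of 1/(1-rho_i); the eigenvalue 1 is removed once).\<close>

definition deg :: "nat \<Rightarrow> (nat \<Rightarrow> nat \<Rightarrow> bool) \<Rightarrow> nat \<Rightarrow> nat" where
  "deg n adj i = card {j. j < n \<and> adj i j}"

definition rw_matrix :: "nat \<Rightarrow> (nat \<Rightarrow> nat \<Rightarrow> bool) \<Rightarrow> complex mat" where
  "rw_matrix n adj = mat n n (\<lambda>(i, j). if adj i j then 1 / of_nat (deg n adj i) else 0)"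

text \<open>Multiplicity of rho among rho_2,...,rho_n: algebraic multiplicity, minus one for rho = 1.\<close>
definition kemeny_mult :: "complex mat \<Rightarrow> complex \<Rightarrow> nat" where
  "kemeny_mult P \<rho> = (if \<rho> = 1 then order \<rho> (char_poly P) - 1 else order \<rho> (char_poly P))"

definition vertex_kemeny :: "nat \<Rightarrow> (nat \<Rightarrow> nat \<Rightarrow> bool) \<Rightarrow> complex" where
  "vertex_kemeny n adj =
     (let P = rw_matrix n adj in
      \<Sum>\<rho> \<in> {\<rho>. poly (char_poly P) \<rho> = 0}. of_nat (kemeny_mult P \<rho>) / (1 - \<rho>))"

text \<open>Cycle barbell CB(k,a,b) on vertices {0..<a+b+k-2}:
  cycle C_a on 0..a-1; path P_k on a-1, a, ..., a+k-2;
  cycle C_b on a+k-2, ..., a+k+b-3.\<close>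

definition cb_step :: "nat \<Rightarrow> nat \<Rightarrow> nat \<Rightarrow> nat \<Rightarrow> nat \<Rightarrow> bool" where
  "cb_step k a b i j \<longleftrightarrow>
     (i < a \<and> j < a \<and> j = (i + 1) mod a) \<or>
     (a - 1 \<le> i \<and> i < a + k - 2 \<and> j = i + 1) \<or>
     (a + k - 2 \<le> i \<and> i < a + k + b - 2 \<and> a + k - 2 \<le> j \<and>
        j - (a + k - 2) = (i - (a + k - 2) + 1) mod b)"

definition cb_adj :: "nat \<Rightarrow> nat \<Rightarrow> nat \<Rightarrow> nat \<Rightarrow> nat \<Rightarrow> bool" where
  "cb_adj k a b i j \<longleftrightarrow> cb_step k a b i j \<or> cb_step k a b j i"

definition cb_nverts :: "nat \<Rightarrow> nat \<Rightarrow> nat \<Rightarrow> nat" where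
  "cb_nverts k a b = a + b + k - 2"

end

theory Submission
  imports Defs
begin

text \<open>Let \<open>J = 1 \<pi>\<^sup>T\<close>. Replacing the transition matrix \<open>P\<close> by \<open>P - J\<close> turns the eigenvalue 1 into 0 and keeps
  the others, so Kemeny's constant is the trace of \<open>(I - P + J)\<inverse>\<close> minus 1, and this inverse is
  obtained from any \<open>G\<close> with \<open>(I - P) G = I - w \<pi>\<^sup>T\<close>. For a graph with \<open>m\<close> edges one may take
  \<open>G\<^sub>i\<^sub>j = - r\<^sub>i\<^sub>j d\<^sub>j / 2\<close> with effective resistances \<open>r\<^sub>i\<^sub>j\<close>, which yields
  \<open>(\<Sum>\<^sub>i\<^sub>j d\<^sub>i d\<^sub>j r\<^sub>i\<^sub>j) / (4 m)\<close>. In the cycle barbell resistances add up over the two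
  cycles and the path, and the three resulting double sums are elementary.\<close>

section \<open>Kemeny's constant as a trace\<close>

definition mat_trace :: "'a :: comm_ring_1 mat \<Rightarrow> 'a" where
  "mat_trace A = (\<Sum>i < dim_row A. A $$ (i, i))"

lemma mat_trace_add:
  assumes "A \<in> carrier_mat n n" "B \<in> carrier_mat n n"
  shows "mat_trace (A + B) = mat_trace A + mat_trace B"
  using assms by (simp add: mat_trace_def sum.distrib)

lemma mat_trace_minus:
  assumes "A \<in> carrier_mat n n" "B \<in> carrier_mat n n"
  shows "mat_trace (A - B) = mat_trace A - mat_trace B"
  using assms by (simp add: mat_trace_def sum_subtractf)

lemma mat_trace_mult_commute:
  assumes A: "A \<in> carrier_mat n m" and B: "B \<in> carrier_mat m n"
  shows "mat_trace (A * B) = mat_trace (B * A)"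
proof -
  have "mat_trace (A * B) = (\<Sum>i<n. \<Sum>j<m. A $$ (i, j) * B $$ (j, i))"
    using A B by (auto simp: mat_trace_def scalar_prod_def atLeast0LessThan intro!: sum.cong)
  also have "\<dots> = (\<Sum>j<m. \<Sum>i<n. B $$ (j, i) * A $$ (i, j))"
    by (subst sum.swap) (simp add: mult.commute)
  also have "\<dots> = mat_trace (B * A)"
    using A B by (auto simp: mat_trace_def scalar_prod_def atLeast0LessThan intro!: sum.cong)
  finally show ?thesis .
qed

section \<open>Determinants and characteristic polynomials under a rank-one change\<close>

lemma smult_one_mat: "1 \<cdot>\<^sub>m A = (A :: 'a :: comm_ring_1 mat)"
  by (intro eq_matI) auto

text \<open>The block matrix \<open>?M\<close> factors both as \<open>?L * ?R\<close> and as
  \<open>?S * ?L\<close>. All three factors are block triangular and \<open>?L\<close> has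
  determinant 1, so the two Schur complements have equal determinants, and one of them is a 1 by 1
  matrix.\<close>

lemma det_one_plus_rank_one:
  fixes U V :: "'a :: idom mat"
  assumes U: "U \<in> carrier_mat n 1" and V: "V \<in> carrier_mat 1 n"
  shows "det (1\<^sub>m n + U * V) = 1 + (V * U) $$ (0, 0)"
proof -
  let ?M = "four_block_mat (1\<^sub>m 1) (- V) U (1\<^sub>m n)"
  let ?L = "four_block_mat (1\<^sub>m 1) (0\<^sub>m 1 n) U (1\<^sub>m n)"
  let ?R = "four_block_mat (1\<^sub>m 1) (- V) (0\<^sub>m n 1) (1\<^sub>m n + U * V)"
  let ?S = "four_block_mat (1\<^sub>m 1 + V * U) (- V) (0\<^sub>m n 1) (1\<^sub>m n)"
  have carr: "?L \<in> carrier_mat (1 + n) (1 + n)" "?R \<in> carrier_mat (1 + n) (1 + n)"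
    "?S \<in> carrier_mat (1 + n) (1 + n)"
    using U V by auto
  have LR: "?L * ?R = ?M"
    by (subst mult_four_block_mat[of _ 1 1 _ n _ n], insert U V, auto intro!: cong_four_block_mat)
  have SL: "?S * ?L = ?M"
    by (subst mult_four_block_mat[of _ 1 1 _ n _ n], insert U V, auto intro!: cong_four_block_mat)
  have detL: "det ?L = 1"
    by (subst det_four_block_mat_upper_right_zero[of _ 1 _ n], insert U V, auto)
  have detR: "det ?R = det (1\<^sub>m n + U * V)"
    by (subst det_four_block_mat_lower_left_zero[of _ 1 _ n], insert U V, auto)
  have detS: "det ?S = det (1\<^sub>m 1 + V * U)"
    by (subst det_four_block_mat_lower_left_zero[of _ 1 _ n], insert U V, auto)
  have "det (1\<^sub>m n + U * V) = det ?M"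
    using det_mult[OF carr(1,2), unfolded LR detL detR] by simp
  also have "\<dots> = det (1\<^sub>m 1 + V * U)"
    using det_mult[OF carr(3,1), unfolded SL detL detS] by simp
  also have "\<dots> = 1 + (V * U) $$ (0, 0)"
    using U V by (subst det_single[where A = "1\<^sub>m 1 + V * U"]) auto
  finally show ?thesis .
qed

lemma poly_char_poly_eq_det:
  fixes A :: "'a :: field mat"
  assumes A: "A \<in> carrier_mat n n"
  shows "poly (char_poly A) x = det (x \<cdot>\<^sub>m 1\<^sub>m n - A)"
proof -
  have "- char_matrix A x = x \<cdot>\<^sub>m 1\<^sub>m n - A"
    using A by (intro eq_matI) (auto simp: char_matrix_def)
  thus ?thesis using char_poly_matrix[OF A] by simp
qed

text \<open>Subtracting \<open>U * V\<close> moves one eigenvalue from 1 to 0. Since (x - P) U = (x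
  - 1) U, the matrix x - P + U V is x - P times a rank-one change of the identity whose determinant
  is x / (x - 1). Cross-multiplying gives an identity of polynomials.\<close>

lemma char_poly_deflate:
  fixes P U V :: "complex mat"
  assumes P: "P \<in> carrier_mat n n" and U: "U \<in> carrier_mat n 1" and V: "V \<in> carrier_mat 1 n"
    and PU: "P * U = U" and VU: "V * U = 1\<^sub>m 1"
  shows "[:-1, 1:] * char_poly (P - U * V) = [:0, 1:] * char_poly P"
proof -
  have UV: "U * V \<in> carrier_mat n n" using U V by auto
  have ne: "poly ([:-1, 1:] * char_poly (P - U * V)) x = poly ([:0, 1:] * char_poly P) x"
    if x: "x \<noteq> 1" for x
  proof -
    \<comment> \<open>This scalar cancels the factor x - 1 by which x - P acts on
      \<open>U\<close>.\<close>
    let ?s = "1 / (x - 1)"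
    have sU: "?s \<cdot>\<^sub>m U \<in> carrier_mat n 1" using U by auto
    have PUV: "P * (U * V) = U * V" using P U V by (simp flip: assoc_mult_mat add: PU)
    have "(x \<cdot>\<^sub>m 1\<^sub>m n - P) * (1\<^sub>m n + (?s \<cdot>\<^sub>m U) * V)
        = (x \<cdot>\<^sub>m 1\<^sub>m n - P) + (x \<cdot>\<^sub>m 1\<^sub>m n - P) * (?s \<cdot>\<^sub>m (U * V))"
      using P U V UV by (simp add: mult_smult_assoc_mat[of _ n 1])
        (subst mult_add_distrib_mat[of _ n n], auto)
    also have "(x \<cdot>\<^sub>m 1\<^sub>m n - P) * (?s \<cdot>\<^sub>m (U * V)) = ?s \<cdot>\<^sub>m ((x \<cdot>\<^sub>m 1\<^sub>m n - P) * (U * V))"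
      using P UV by (intro mult_smult_distrib) auto
    also have "(x \<cdot>\<^sub>m 1\<^sub>m n - P) * (U * V) = x \<cdot>\<^sub>m (U * V) - U * V"
      using P UV by (subst minus_mult_distrib_mat[of _ n n])
        (auto simp: PUV mult_smult_assoc_mat[of _ n n])
    also have "?s \<cdot>\<^sub>m (x \<cdot>\<^sub>m (U * V) - U * V) = U * V"
      using x U V by (intro eq_matI) (auto simp: field_simps simp del: index_mult_mat(1))
    also have "(x \<cdot>\<^sub>m 1\<^sub>m n - P) + U * V = x \<cdot>\<^sub>m 1\<^sub>m n - (P - U * V)"
      using P U V by (intro eq_matI) (auto simp del: index_mult_mat(1))
    finally have eq: "(x \<cdot>\<^sub>m 1\<^sub>m n - P) * (1\<^sub>m n + (?s \<cdot>\<^sub>m U) * V) = x \<cdot>\<^sub>m 1\<^sub>m n - (P - U * V)" .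
    have "poly (char_poly (P - U * V)) x = det ((x \<cdot>\<^sub>m 1\<^sub>m n - P) * (1\<^sub>m n + (?s \<cdot>\<^sub>m U) * V))"
      unfolding eq using UV by (intro poly_char_poly_eq_det minus_carrier_mat)
    also have "\<dots> = det (x \<cdot>\<^sub>m 1\<^sub>m n - P) * det (1\<^sub>m n + (?s \<cdot>\<^sub>m U) * V)"
      using P U V by (intro det_mult) auto
    also have "det (1\<^sub>m n + (?s \<cdot>\<^sub>m U) * V) = 1 + (V * (?s \<cdot>\<^sub>m U)) $$ (0, 0)"
      using sU V by (rule det_one_plus_rank_one)
    also have "V * (?s \<cdot>\<^sub>m U) = ?s \<cdot>\<^sub>m 1\<^sub>m 1"
      using U V VU by (metis mult_smult_distrib)
    also have "det (x \<cdot>\<^sub>m 1\<^sub>m n - P) = poly (char_poly P) x"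
      using P by (simp add: poly_char_poly_eq_det)
    finally show ?thesis using x by (simp add: field_simps)
  qed
  let ?D = "[:-1, 1:] * char_poly (P - U * V) - [:0, 1:] * char_poly P"
  \<comment> \<open>The identity is known everywhere except at 1, so the difference of the two
    polynomials has infinitely many zeros and must vanish.\<close>
  have "- {1} \<subseteq> {x. poly ?D x = 0}" using ne by auto
  hence "infinite {x. poly ?D x = 0}"
    by (rule infinite_super) (simp add: infinite_UNIV_char_0 Compl_eq_Diff_UNIV)
  thus ?thesis using poly_roots_finite[of ?D] by force
qed

section \<open>Sums over eigenvalues from the logarithmic derivative of the characteristic
  polynomial\<close>

lemma logderiv_linear_factors:
  fixes x :: "'a :: {field, idom_divide}"
  assumes "x \<notin> set es"
  shows "poly (pderiv (\<Prod>e\<leftarrow>es. [:- e, 1:])) x = poly (\<Prod>e\<leftarrow>es. [:- e, 1:]) x * (\<Sum>e\<leftarrow>es. 1 / (x - e))"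
  using assms
proof (induction es)
  case (Cons a es)
  let ?p = "\<Prod>e\<leftarrow>es. [:- e, 1:]"
  define S where "S = (\<Sum>e\<leftarrow>es. 1 / (x - e))"
  have "poly (pderiv ([:- a, 1:] * ?p)) x = (x - a) * poly (pderiv ?p) x + poly ?p x"
    by (simp only: pderiv_mult) (simp add: pderiv_pCons algebra_simps)
  also have "\<dots> = (x - a) * poly ?p x * S + poly ?p x"
    using Cons by (simp add: S_def)
  also have "\<dots> = (x - a) * poly ?p x * (1 / (x - a) + S)"
    using Cons.prems by (simp add: distrib_left)
  also have "(x - a) * poly ?p x = poly ([:- a, 1:] * ?p) x"
    by (simp add: algebra_simps)
  finally show ?case by (simp add: S_def del: mult_pCons_left)
qed simp

lemma order_linear_factors:
  "order x (\<Prod>e\<leftarrow>es. [:- e, 1:]) = count_list es (x :: 'a :: idom)"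
proof (induction es)
  case (Cons e es)
  have "(\<Prod>e\<leftarrow>es. [:- e, 1:]) \<noteq> 0"
    by (auto simp: prod_list_zero_iff)
  thus ?case using Cons by (simp add: order_mult order_linear' del: mult_pCons_left)
qed auto

lemma sum_list_eq_sum_count_list:
  fixes f :: "'a \<Rightarrow> 'b :: comm_semiring_1"
  shows "(\<Sum>e\<leftarrow>es. f e) = (\<Sum>e\<in>set es. of_nat (count_list es e) * f e)"
proof -
  \<comment> \<open>The index set is generalised to any finite superset, because
    \<open>set es\<close> itself changes along the induction.\<close>
  have "(\<Sum>e\<leftarrow>es. f e) = (\<Sum>e\<in>S. of_nat (count_list es e) * f e)"
    if "finite S" "set es \<subseteq> S" for S
    using that(2)
  proof (induction es)
    case (Cons e es)
    have "(\<Sum>y\<in>S. of_nat (count_list (e # es) y) * f y)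
        = (\<Sum>y\<in>S. (if e = y then f y else 0) + of_nat (count_list es y) * f y)"
      by (intro sum.cong) (auto simp: algebra_simps)
    also have "\<dots> = f e + (\<Sum>y\<in>S. of_nat (count_list es y) * f y)"
      using Cons.prems that(1) by (simp add: sum.distrib)
    finally show ?case using Cons by simp
  qed auto
  thus ?thesis by simp
qed

text \<open>With chi the characteristic polynomial of \<open>N\<close>, the sum of 1 / (1 - rho) is
  chi'(1) / chi(1). The derivative is the sum of the characteristic polynomials of the principal
  minors; at 1 these are the diagonal cofactors of I - N, that is, det (I - N) times the diagonal
  entries of the inverse \<open>Z\<close>.\<close>

lemma sum_order_resolvent:
  fixes N Z :: "complex mat"
  assumes N: "N \<in> carrier_mat n n" and Z: "Z \<in> carrier_mat n n"
    and inv: "(1\<^sub>m n - N) * Z = 1\<^sub>m n"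
  shows "poly (char_poly N) 1 \<noteq> 0"
    and "(\<Sum>\<rho> | poly (char_poly N) \<rho> = 0. of_nat (order \<rho> (char_poly N)) / (1 - \<rho>)) = mat_trace Z"
proof -
  define M where "M = 1\<^sub>m n - N"
  have M: "M \<in> carrier_mat n n" using N by (auto simp: M_def)
  have MZ: "M * Z = 1\<^sub>m n" using inv by (simp add: M_def)
  have "det M * det Z = 1"
    using det_mult[OF M Z] MZ by simp
  hence detM: "det M \<noteq> 0" by auto
  have chi1: "poly (char_poly N) 1 = det M"
    using poly_char_poly_eq_det[OF N, of 1] by (simp add: M_def smult_one_mat)
  show nz: "poly (char_poly N) 1 \<noteq> 0" using chi1 detM by simp
  \<comment> \<open>The adjugate is compared with the given right inverse: adj M times M is det M,
    so associativity leaves \<open>det M\<close> times \<open>Z\<close>.\<close>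
  have "adj_mat M = adj_mat M * (M * Z)" using MZ adj_mat(1)[OF M] by simp
  also have "\<dots> = det M \<cdot>\<^sub>m Z"
    using adj_mat[OF M] M Z by (simp flip: assoc_mult_mat add: mult_smult_assoc_mat[of _ n n])
  finally have adj: "adj_mat M = det M \<cdot>\<^sub>m Z" .
  have del: "poly (char_poly (mat_delete N i i)) 1 = det M * Z $$ (i, i)" if i: "i < n" for i
  proof -
    have "mat_delete N i i \<in> carrier_mat (n - 1) (n - 1)" using N mat_delete_carrier by blast
    hence "poly (char_poly (mat_delete N i i)) 1 = det (1 \<cdot>\<^sub>m 1\<^sub>m (n - 1) - mat_delete N i i)"
      by (rule poly_char_poly_eq_det)
    also have "1 \<cdot>\<^sub>m 1\<^sub>m (n - 1) - mat_delete N i i = mat_delete M i i"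
      using N i by (intro eq_matI) (auto simp: mat_delete_def M_def)
    \<comment> \<open>On the diagonal the cofactor sign is (-1)^(i+i) = 1, and transposing the
      indices has no effect.\<close>
    also have "det \<dots> = adj_mat M $$ (i, i)"
      using M i by (simp add: adj_mat_def cofactor_def power_add[symmetric] flip: mult_2)
    finally show ?thesis using adj i Z by simp
  qed
  have pd: "poly (pderiv (char_poly N)) 1 = det M * mat_trace Z"
    unfolding pderiv_char_poly[OF N] using Z
    by (simp add: poly_sum del mat_trace_def sum_distrib_left)
  obtain es where es: "char_poly N = (\<Prod>e\<leftarrow>es. [:- e, 1:])"
    using char_poly_factorized[OF N] by auto
  have roots: "{\<rho>. poly (char_poly N) \<rho> = 0} = set es"
    unfolding es by (auto simp: poly_prod_list prod_list_zero_iff)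
  have "1 \<notin> set es" using nz roots by auto
  from logderiv_linear_factors[OF this] have "mat_trace Z = (\<Sum>e\<leftarrow>es. 1 / (1 - e))"
    using pd chi1 detM unfolding es by simp
  also have "\<dots> = (\<Sum>\<rho> | poly (char_poly N) \<rho> = 0. of_nat (order \<rho> (char_poly N)) / (1 - \<rho>))"
    unfolding roots sum_list_eq_sum_count_list by (simp add: es order_linear_factors)
  finally show "(\<Sum>\<rho> | poly (char_poly N) \<rho> = 0. of_nat (order \<rho> (char_poly N)) / (1 - \<rho>)) = mat_trace Z"
    by simp
qed

section \<open>Kemeny's constant from a generalised inverse of I - P\<close>

lemma minus_zero_mat:
  "A \<in> carrier_mat n m \<Longrightarrow> A - 0\<^sub>m n m = (A :: 'a :: group_add mat)"
  by (intro eq_matI) auto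

text \<open>In the application \<open>U\<close> is the all-ones column and \<open>V\<close> the
  stationary row. Any \<open>G\<close> that inverts I - P up to an error \<open>W * V\<close> will
  do: projecting away \<open>U\<close> on both sides removes the error, and the trace then depends
  on \<open>G\<close> only through the two terms shown.\<close>

lemma kemeny_sum_eq_trace:
  fixes P U V W G :: "complex mat"
  assumes P: "P \<in> carrier_mat n n" and U: "U \<in> carrier_mat n 1" and V: "V \<in> carrier_mat 1 n"
    and W: "W \<in> carrier_mat n 1" and G: "G \<in> carrier_mat n n"
    and PU: "P * U = U" and VP: "V * P = V" and VU: "V * U = 1\<^sub>m 1"
    and LG: "(1\<^sub>m n - P) * G = 1\<^sub>m n - W * V"
  shows "(\<Sum>\<rho> | poly (char_poly P) \<rho> = 0. of_nat (kemeny_mult P \<rho>) / (1 - \<rho>))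
    = mat_trace G - mat_trace (U * V * G)"
proof -
  define J where "J = U * V"
  define F where "F = 1\<^sub>m n - J"
  define L where "L = 1\<^sub>m n - P"
  define N where "N = P - J"
  \<comment> \<open>\<open>F\<close> is the projection complementary to \<open>J\<close>. The factor
    on the right kills the error because \<open>V * F\<close> vanishes; the one on the left is
    harmless to L = I - P because \<open>L * F\<close> is \<open>L\<close>, and it makes
    \<open>J\<close> annihilate the product. Hence \<open>L + J\<close> has the inverse
    \<open>Z\<close>.\<close>
  define Z where "Z = F * G * F + J"
  have carr [simp]: "J \<in> carrier_mat n n" "F \<in> carrier_mat n n" "L \<in> carrier_mat n n"
    "N \<in> carrier_mat n n" "Z \<in> carrier_mat n n"
    using U V P G by (auto simp: J_def F_def L_def N_def Z_def)
  note [simp] = P U V W G U[unfolded One_nat_def] V[unfolded One_nat_def] W[unfolded One_nat_def]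
  have VJ: "V * J = V"
    unfolding J_def assoc_mult_mat[OF V U V, symmetric] VU using V by (rule left_mult_one_mat)
  have JJ: "J * J = J"
    using assoc_mult_mat[OF U V carr(1)] by (simp only: VJ flip: J_def)
  have LU: "L * U = 0\<^sub>m n 1"
    unfolding L_def minus_mult_distrib_mat[OF one_carrier_mat P U] PU
    by (simp add: left_mult_one_mat[OF U] minus_r_inv_mat[OF U])
  have LJ: "L * J = 0\<^sub>m n n"
    unfolding J_def assoc_mult_mat[OF carr(3) U V, symmetric] LU using V by (rule left_mult_zero_mat)
  have JF: "J * F = 0\<^sub>m n n"
    unfolding F_def mult_minus_distrib_mat[OF carr(1) one_carrier_mat carr(1)] JJ
    by (simp add: right_mult_one_mat[OF carr(1)] minus_r_inv_mat[OF carr(1)])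
  have VF: "V * F = 0\<^sub>m 1 n"
    unfolding F_def mult_minus_distrib_mat[OF V one_carrier_mat carr(1)] VJ
    by (simp add: right_mult_one_mat[OF V] minus_r_inv_mat[OF V])
  have LF: "L * F = L"
    unfolding F_def mult_minus_distrib_mat[OF carr(3) one_carrier_mat carr(1)] LJ
    by (simp add: right_mult_one_mat[OF carr(3)] minus_zero_mat[OF carr(3)])
  have FF: "F * F = F"
    using minus_mult_distrib_mat[OF one_carrier_mat carr(1,2)]
    by (simp add: JF left_mult_one_mat[OF carr(2)] minus_zero_mat[OF carr(2)] flip: F_def)
  have FG: "F * G \<in> carrier_mat n n" using carr(2) G by (rule mult_carrier_mat)
  have FGF: "F * G * F \<in> carrier_mat n n" using FG carr(2) by (rule mult_carrier_mat)
  have JG: "J * G \<in> carrier_mat n n" using carr(1) G by (rule mult_carrier_mat)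
  have WV: "W * V \<in> carrier_mat n n" using W V by (rule mult_carrier_mat)
  have "L * (F * G * F) = L * F * G * F"
    using assoc_mult_mat[OF carr(3) FG carr(2)] assoc_mult_mat[OF carr(3,2) G] by simp
  also have "\<dots> = (1\<^sub>m n - W * V) * F" unfolding LF using LG by (simp add: L_def)
  also have "\<dots> = F"
    unfolding minus_mult_distrib_mat[OF one_carrier_mat WV carr(2)] assoc_mult_mat[OF W V carr(2)] VF
    by (simp add: right_mult_zero_mat[OF W, unfolded One_nat_def] left_mult_one_mat[OF carr(2)] minus_zero_mat[OF carr(2)])
  finally have LFGF: "L * (F * G * F) = F" .
  have "J * (F * G * F) = J * F * G * F"
    using assoc_mult_mat[OF carr(1) FG carr(2)] assoc_mult_mat[OF carr(1,2) G] by simp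
  hence JFGF: "J * (F * G * F) = 0\<^sub>m n n"
    by (simp add: JF left_mult_zero_mat[OF G] left_mult_zero_mat[OF carr(2)])
  have "1\<^sub>m n - N = L + J"
    using P U V carrier_matD[OF P] carrier_matD[OF U] carrier_matD[OF V]
    by (intro eq_matI) (auto simp: L_def N_def J_def simp del: index_mult_mat(1))
  hence "(1\<^sub>m n - N) * Z = L * Z + J * Z"
    using add_mult_distrib_mat[OF carr(3,1,5)] by simp
  also have "L * Z = F"
    unfolding Z_def mult_add_distrib_mat[OF carr(3) FGF carr(1)] LFGF LJ using carr(2) by simp
  also have "J * Z = J"
    unfolding Z_def mult_add_distrib_mat[OF carr(1) FGF carr(1)] JFGF JJ using carr(1) by simp
  also have "F + J = 1\<^sub>m n"
    using carrier_matD[OF U] carrier_matD[OF V]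
    by (intro eq_matI) (auto simp: F_def J_def simp del: index_mult_mat(1))
  finally have inv: "(1\<^sub>m n - N) * Z = 1\<^sub>m n" .
  note res = sum_order_resolvent[OF carr(4,5) inv]

  have trJ: "mat_trace J = 1"
    unfolding J_def mat_trace_mult_commute[OF U V] VU by (simp add: mat_trace_def)
  \<comment> \<open>Cyclicity of the trace and idempotence of \<open>F\<close> remove one of the two
    projections.\<close>
  have "mat_trace (F * G * F) = mat_trace (F * (F * G))"
    using FG by (rule mat_trace_mult_commute) simp
  also have "F * (F * G) = F * G"
    using assoc_mult_mat[OF carr(2,2) G] by (simp add: FF)
  also have "mat_trace (F * G) = mat_trace (G - J * G)"
    unfolding F_def minus_mult_distrib_mat[OF one_carrier_mat carr(1) G] left_mult_one_mat[OF G] ..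
  also have "\<dots> = mat_trace G - mat_trace (J * G)"
    using G JG by (rule mat_trace_minus)
  finally have trZ: "mat_trace Z = mat_trace G - mat_trace (U * V * G) + 1"
    unfolding Z_def mat_trace_add[OF FGF carr(1)] trJ by (simp add: J_def)

  let ?p = "char_poly P" and ?q = "char_poly N"
  have defl: "[:-1, 1:] * ?q = [:0, 1:] * ?p"
    using char_poly_deflate[OF P U V PU VU] by (simp add: N_def J_def)
  have p0: "?p \<noteq> 0" and q0: "?q \<noteq> 0"
    using degree_monic_char_poly[OF P] degree_monic_char_poly[of N n] by auto
  \<comment> \<open>Comparing the order at each point in the deflation identity: the multiplicities
    for \<open>P\<close> and \<open>N\<close> differ only at 0, where \<open>N\<close> has one more,
    and at 1, where it has one fewer.\<close>
  have ord: "order \<rho> ?p + (if \<rho> = 0 then 1 else 0) = order \<rho> ?q + (if \<rho> = 1 then 1 else 0)" for \<rho>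
  proof -
    have "order \<rho> ([:-1, 1:] * ?q) = (if \<rho> = 1 then 1 else 0) + order \<rho> ?q"
      using q0 by (subst order_mult) (auto simp: order_linear' simp del: mult_pCons_left)
    moreover have "order \<rho> ([:0, 1:] * ?p) = (if \<rho> = 0 then 1 else 0) + order \<rho> ?p"
      using p0 order_linear'[of \<rho> 0]
      by (subst order_mult) (auto simp del: mult_pCons_left)
    ultimately show ?thesis using defl by simp
  qed
  have q1: "order 1 ?q = 0" using res(1) by (simp add: order_0I)
  have q00: "poly ?q 0 = 0" using arg_cong[OF defl, of "\<lambda>r. poly r 0"] by simp
  \<comment> \<open>The unit that \<open>kemeny_mult\<close> removes at 1 is exactly the factor lost
    by deflation. What remains is the additional root 0 of \<open>?q\<close>, which contributes 1 /
    (1 - 0) = 1.\<close>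
  have term_eq: "of_nat (kemeny_mult P \<rho>) / (1 - \<rho>)
      = of_nat (order \<rho> ?q) / (1 - \<rho>) - (if \<rho> = 0 then 1 else 0)" for \<rho>
  proof (cases "\<rho> = 0")
    case True
    hence "order \<rho> ?q = Suc (kemeny_mult P \<rho>)" using ord[of \<rho>] by (simp add: kemeny_mult_def)
    thus ?thesis using True by simp
  qed (use ord[of \<rho>] in \<open>auto simp: kemeny_mult_def\<close>)
  \<comment> \<open>The two root sets may differ at 0 and 1, but a point lying in only one of them
    has \<open>kemeny_mult\<close> equal to 0.\<close>
  have "(\<Sum>\<rho> | poly ?p \<rho> = 0. of_nat (kemeny_mult P \<rho>) / (1 - \<rho>))
      = (\<Sum>\<rho> | poly ?q \<rho> = 0. of_nat (kemeny_mult P \<rho>) / (1 - \<rho>))"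
  proof (intro sum.mono_neutral_cong)
    fix \<rho> assume "\<rho> \<in> {\<rho>. poly ?p \<rho> = 0} - {\<rho>. poly ?q \<rho> = 0}"
    hence "order \<rho> ?q = 0" "\<rho> \<noteq> 0" using q00 by (auto simp: order_0I)
    thus "of_nat (kemeny_mult P \<rho>) / (1 - \<rho>) = (0 :: complex)" by (simp add: term_eq)
  next
    fix \<rho> assume "\<rho> \<in> {\<rho>. poly ?q \<rho> = 0} - {\<rho>. poly ?p \<rho> = 0}"
    hence "order \<rho> ?p = 0" by (auto simp: order_0I)
    thus "of_nat (kemeny_mult P \<rho>) / (1 - \<rho>) = (0 :: complex)" by (simp add: kemeny_mult_def)
  qed (use p0 q0 in \<open>auto intro: poly_roots_finite\<close>)
  also have "\<dots> = (\<Sum>\<rho> | poly ?q \<rho> = 0. of_nat (order \<rho> ?q) / (1 - \<rho>)) - 1"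
    using q00 poly_roots_finite[OF q0] by (simp add: term_eq sum_subtractf)
  also have "\<dots> = mat_trace G - mat_trace (U * V * G)"
    by (simp add: res(2) trZ)
  finally show ?thesis .
qed

section \<open>Effective resistances\<close>

text \<open>Condition \<open>lap\<close> says that the graph Laplacian sends column \<open>j\<close>
  of \<open>r\<close> to \<open>c\<close> minus twice the \<open>j\<close>-th unit vector, with
  \<open>c\<close> independent of \<open>j\<close>. Effective resistances satisfy this, so it
  suffices to exhibit a candidate \<open>r\<close> and verify it, without any theory of electrical
  networks.\<close>

theorem vertex_kemeny_eq_resistance_sum:
  fixes r :: "nat \<Rightarrow> nat \<Rightarrow> real" and c :: "nat \<Rightarrow> real"
  assumes n: "n > 0"
    and sym: "\<And>i j. i < n \<Longrightarrow> j < n \<Longrightarrow> adj i j \<longleftrightarrow> adj j i"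
    and degpos: "\<And>i. i < n \<Longrightarrow> deg n adj i > 0"
    and diag: "\<And>i. i < n \<Longrightarrow> r i i = 0"
    and lap: "\<And>i j. i < n \<Longrightarrow> j < n \<Longrightarrow>
      (\<Sum>l | l < n \<and> adj i l. r i j - r l j) = c i - (if i = j then 2 else 0)"
  shows "vertex_kemeny n adj = complex_of_real
    ((\<Sum>i<n. real (deg n adj i) * (\<Sum>j<n. real (deg n adj j) * r i j)) / (2 * (\<Sum>i<n. real (deg n adj i))))"
proof -
  let ?d = "\<lambda>i. real (deg n adj i)"
  define D where "D = (\<Sum>i<n. ?d i)"
  have "D > 0" unfolding D_def using n degpos by (intro sum_pos) auto
  define P where "P = rw_matrix n adj"
  define U where "U = mat n 1 (\<lambda>_. 1 :: complex)"
  define V where "V = mat 1 n (\<lambda>(_, j). complex_of_real (?d j / D))"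
  \<comment> \<open>Dividing row \<open>i\<close> of \<open>lap\<close> by the degree d_i and
    scaling column \<open>j\<close> by -d_j / 2 gives the identity minus c_i d_j / (2 d_i).
    \<open>W\<close> is chosen so that \<open>W * V\<close> is this rank-one remainder.\<close>
  define W where "W = mat n 1 (\<lambda>(i, _). complex_of_real (c i * D / (2 * ?d i)))"
  define G where "G = mat n n (\<lambda>(i, j). complex_of_real (- r i j * ?d j / 2))"
  have P: "P \<in> carrier_mat n n" and U: "U \<in> carrier_mat n 1" and V: "V \<in> carrier_mat 1 n"
    and W: "W \<in> carrier_mat n 1" and G: "G \<in> carrier_mat n n"
    by (auto simp: P_def rw_matrix_def U_def V_def W_def G_def)
  have Psum: "(\<Sum>l<n. P $$ (i, l) * f l) = (\<Sum>l | l < n \<and> adj i l. f l) / of_nat (deg n adj i)"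
    if "i < n" for i f
  proof -
    have "(\<Sum>l<n. P $$ (i, l) * f l) = (\<Sum>l<n. if adj i l then f l / of_nat (deg n adj i) else 0)"
      using that by (intro sum.cong) (auto simp: P_def rw_matrix_def)
    also have "\<dots> = (\<Sum>l | l < n \<and> adj i l. f l / of_nat (deg n adj i))"
      by (subst sum.inter_filter[symmetric]) (auto intro!: sum.cong)
    finally show ?thesis by (simp add: sum_divide_distrib)
  qed
  have card: "card {l. l < n \<and> adj i l} = deg n adj i" for i by (simp add: deg_def)
  have PU: "P * U = U"
  proof (rule eq_matI)
    fix i j assume ij: "i < dim_row U" "j < dim_col U"
    hence "(P * U) $$ (i, j) = (\<Sum>l<n. P $$ (i, l) * 1)"
      using P by (auto simp: U_def scalar_prod_def atLeast0LessThan intro!: sum.cong)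
    also have "\<dots> = 1" using ij degpos[of i] by (subst Psum) (auto simp: U_def card)
    finally show "(P * U) $$ (i, j) = U $$ (i, j)" using ij by (simp add: U_def)
  qed (use P U in auto)
  have VP: "V * P = V"
  proof (rule eq_matI)
    fix i j assume ij: "i < dim_row V" "j < dim_col V"
    hence j: "j < n" by (simp add: V_def)
    have "(V * P) $$ (i, j) = (\<Sum>l<n. complex_of_real (?d l / D) * P $$ (l, j))"
      using P ij by (auto simp: V_def scalar_prod_def atLeast0LessThan intro!: sum.cong)
    \<comment> \<open>Detailed balance: the degree of \<open>l\<close> cancels, and symmetry turns
      the edges into \<open>j\<close> into edges out of \<open>j\<close>.\<close>
    also have "\<dots> = (\<Sum>l<n. if adj j l then complex_of_real (1 / D) else 0)"
      using degpos j sym by (intro sum.cong refl) (force simp: P_def rw_matrix_def)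
    also have "\<dots> = (\<Sum>l | l < n \<and> adj j l. complex_of_real (1 / D))"
      by (subst sum.inter_filter[symmetric]) (auto intro!: sum.cong)
    also have "\<dots> = V $$ (i, j)" using ij by (simp add: V_def card)
    finally show "(V * P) $$ (i, j) = V $$ (i, j)" .
  qed (use P V in auto)
  have VU: "V * U = 1\<^sub>m 1"
  proof (rule eq_matI)
    fix i j assume ij: "i < dim_row (1\<^sub>m 1 :: complex mat)" "j < dim_col (1\<^sub>m 1 :: complex mat)"
    have "(V * U) $$ (i, j) = (\<Sum>l<n. complex_of_real (?d l / D))"
      using ij by (auto simp: U_def V_def scalar_prod_def atLeast0LessThan intro!: sum.cong)
    also have "\<dots> = complex_of_real ((\<Sum>l<n. ?d l) / D)" by (simp add: sum_divide_distrib)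
    also have "\<dots> = 1" using \<open>D > 0\<close> by (simp flip: D_def)
    finally show "(V * U) $$ (i, j) = 1\<^sub>m 1 $$ (i, j)" using ij by simp
  qed (use U V in auto)
  have LG: "(1\<^sub>m n - P) * G = 1\<^sub>m n - W * V"
  proof (rule eq_matI)
    fix i j assume "i < dim_row (1\<^sub>m n - W * V)" "j < dim_col (1\<^sub>m n - W * V)"
    hence ij: "i < n" "j < n" using W V by auto
    let ?N = "{l. l < n \<and> adj i l}"
    have d0: "?d i > 0" "?d j > 0" using degpos ij by auto
    have "((1\<^sub>m n - P) * G) $$ (i, j) = (\<Sum>l<n. (if i = l then G $$ (l, j) else 0) - P $$ (i, l) * G $$ (l, j))"
      using P G ij by (auto simp: scalar_prod_def atLeast0LessThan algebra_simps intro!: sum.cong)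
    also have "\<dots> = G $$ (i, j) - (\<Sum>l\<in>?N. G $$ (l, j)) / of_nat (deg n adj i)"
      using ij by (simp add: sum_subtractf Psum)
    also have "\<dots> = complex_of_real (- r i j * ?d j / 2 - (\<Sum>l\<in>?N. - r l j * ?d j / 2) / ?d i)"
      using ij by (simp add: G_def)
    also have "(\<Sum>l\<in>?N. - r l j * ?d j / 2) = (- (\<Sum>l\<in>?N. r l j)) * ?d j / 2"
      by (simp add: sum_distrib_right sum_divide_distrib sum_negf)
    also have "(\<Sum>l\<in>?N. r l j) = ?d i * r i j - (c i - (if i = j then 2 else 0))"
      using lap[OF ij] by (simp add: sum_subtractf card)
    also have "- r i j * ?d j / 2 - - (?d i * r i j - (c i - (if i = j then 2 else 0))) * ?d j / 2 / ?d i
      = (if i = j then 1 else 0) - c i * D / (2 * ?d i) * (?d j / D)"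
      using d0 \<open>D > 0\<close> by (auto simp: field_simps)
    also have "complex_of_real \<dots> = (1\<^sub>m n - W * V) $$ (i, j)"
      using ij W V by (simp add: scalar_prod_def W_def V_def)
    finally show "((1\<^sub>m n - P) * G) $$ (i, j) = (1\<^sub>m n - W * V) $$ (i, j)" .
  qed (use P G W V in auto)
  have "vertex_kemeny n adj = mat_trace G - mat_trace (U * V * G)"
    using kemeny_sum_eq_trace[OF P U V W G PU VP VU LG]
    by (simp add: vertex_kemeny_def P_def Let_def)
  also have "mat_trace G = 0" using diag by (simp add: mat_trace_def G_def)
  also have "mat_trace (U * V * G) = (\<Sum>j<n. \<Sum>i<n. complex_of_real (?d i / D * (- r i j * ?d j / 2)))"
    using U V G by (auto simp: mat_trace_def scalar_prod_def U_def V_def G_def atLeast0LessThan intro!: sum.cong)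
  also have "\<dots> = complex_of_real (\<Sum>i<n. \<Sum>j<n. ?d i / D * (- r i j * ?d j / 2))"
    by (subst sum.swap) simp
  also have "(\<Sum>i<n. \<Sum>j<n. ?d i / D * (- r i j * ?d j / 2)) = - ((\<Sum>i<n. ?d i * (\<Sum>j<n. ?d j * r i j)) / (2 * D))"
    by (simp add: sum_divide_distrib sum_distrib_left sum_negf algebra_simps)
  finally show ?thesis by (simp add: D_def)
qed

section \<open>Cycles and paths\<close>

text \<open>Two arcs of lengths t and m - t connected in parallel have resistance t (m - t) / m.
  This is invariant under exchanging t with m - t, so the distance of the labels serves without
  reduction modulo \<open>m\<close>.\<close>

definition cycle_res :: "nat \<Rightarrow> nat \<Rightarrow> nat \<Rightarrow> real" where
  "cycle_res m x y = \<bar>real x - real y\<bar> * (real m - \<bar>real x - real y\<bar>) / real m"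

lemma cycle_res_self [simp]: "cycle_res m x x = 0"
  by (simp add: cycle_res_def)

lemma cycle_res_commute: "cycle_res m x y = cycle_res m y x"
  by (simp add: cycle_res_def abs_minus_commute)

lemma cycle_res_le:
  assumes "x \<le> y"
  shows "cycle_res m x y = (real y - real x) * (real m - (real y - real x)) / real m"
    and "cycle_res m y x = (real y - real x) * (real m - (real y - real x)) / real m"
  using assms by (auto simp: cycle_res_def)

text \<open>As a function of the distance t the resistance is quadratic with second difference -2 /
  m; the kink at t = 0 supplies the extra -2.\<close>

lemma cycle_res_laplacian_interior:
  assumes "0 < x" "x + 1 < m" "y < m"
  shows "2 * cycle_res m x y - cycle_res m (x - 1) y - cycle_res m (x + 1) y
    = 2 / real m - (if x = y then 2 else 0)"
proof -
  consider "x < y" | "x = y" | "y < x" by linarith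
  thus ?thesis
    using assms by cases (auto simp: cycle_res_le of_nat_diff field_simps)
qed

text \<open>Here one neighbour lies across the closing edge and its label is not consecutive; the
  invariance under exchanging t with m - t gives the same value as in the interior.\<close>

lemma cycle_res_laplacian_first:
  assumes "2 < m" "y < m"
  shows "2 * cycle_res m 0 y - cycle_res m 1 y - cycle_res m (m - 1) y
    = 2 / real m - (if y = 0 then 2 else 0)"
  using assms by (cases "y = 0") (auto simp: cycle_res_le of_nat_diff field_simps)

lemma cycle_res_laplacian_last:
  assumes "2 < m" "y < m"
  shows "2 * cycle_res m (m - 1) y - cycle_res m (m - 2) y - cycle_res m 0 y
    = 2 / real m - (if y = m - 1 then 2 else 0)"
  using assms by (cases "y = m - 1") (auto simp: cycle_res_le of_nat_diff field_simps)

text \<open>The distance is linear away from its kink, so there is no constant term. The ends of the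
  path are cut vertices of the barbell and are treated together with the cycles there.\<close>

lemma path_res_laplacian_interior:
  fixes x y :: nat
  assumes "0 < x"
  shows "2 * \<bar>real x - real y\<bar> - \<bar>real (x - 1) - real y\<bar> - \<bar>real (x + 1) - real y\<bar>
    = - (if x = y then 2 else 0)"
proof -
  consider "x + 1 \<le> y" | "x = y" | "y + 1 \<le> x" by linarith
  thus ?thesis using assms by cases (auto simp: of_nat_diff)
qed

section \<open>Sums of resistances over a cycle and over a path\<close>

lemma sum_upto_res: "(\<Sum>d<N. real d * (t - real d)) = t * real N * (real N - 1) / 2
    - (real N - 1) * real N * (2 * real N - 1) / 6"
  by (induction N) (auto simp: field_simps)

text \<open>The vertices below \<open>x\<close> have distances 1 to x and the others 0 to m - x - 1.
  Reflecting the second range by d to m - d completes the first to all distances up to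
  \<open>m\<close>, so the sum does not depend on \<open>x\<close>.\<close>

lemma sum_cycle_res:
  assumes "x < m"
  shows "(\<Sum>y<m. cycle_res m x y) = ((real m)\<^sup>2 - 1) / 6"
proof -
  let ?g = "\<lambda>d. real d * (real m - real d)"
  have "(\<Sum>y<m. cycle_res m x y) = (\<Sum>y<x. cycle_res m x y) + (\<Sum>y=x..<m. cycle_res m x y)"
    using assms sum.atLeastLessThan_concat[of 0 x m "cycle_res m x"] by (simp add: atLeast0LessThan)
  also have "(\<Sum>y<x. cycle_res m x y) = (\<Sum>d<x. ?g (Suc d) / real m)"
    by (rule sum.reindex_bij_witness[of _ "\<lambda>d. x - Suc d" "\<lambda>y. x - Suc y"])
      (auto simp: cycle_res_le of_nat_diff)
  \<comment> \<open>The vanishing term at distance 0 is put in front, so that both parts are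
    instances of \<open>sum_upto_res\<close> with t = m.\<close>
  also have "\<dots> = (\<Sum>d<Suc x. ?g d / real m)"
    by (subst sum.lessThan_Suc_shift) simp
  also have "(\<Sum>y=x..<m. cycle_res m x y) = (\<Sum>d<m - x. ?g d / real m)"
    by (rule sum.reindex_bij_witness[of _ "\<lambda>d. x + d" "\<lambda>y. y - x"])
      (auto simp: cycle_res_le of_nat_diff)
  finally have "(\<Sum>y<m. cycle_res m x y) = ((\<Sum>d<Suc x. ?g d) + (\<Sum>d<m - x. ?g d)) / real m"
    by (simp only: add_divide_distrib sum_divide_distrib)
  also have "\<dots> = ((real m)\<^sup>2 - 1) / 6"
    unfolding sum_upto_res using assms by (simp add: of_nat_diff field_simps power2_eq_square)
  finally show ?thesis .
qed

lemma sum_abs_diff_last: "(\<Sum>y<k. \<bar>real k - real y\<bar>) = real k * (real k + 1) / 2"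
proof -
  have "(\<Sum>y<k. \<bar>real k - real y\<bar>) = (\<Sum>y<k. real k - real y)"
    by (intro sum.cong) auto
  also have "(\<Sum>y<k. t - real y) = real k * t - real k * (real k - 1) / 2" for t
    by (induction k) (auto simp: field_simps)
  finally show ?thesis by (simp add: field_simps)
qed

lemma sum_sum_abs_diff: "(\<Sum>x<k. \<Sum>y<k. \<bar>real x - real y\<bar>) = (real k ^ 3 - real k) / 3"
proof (induction k)
  case (Suc k)
  have "(\<Sum>x<Suc k. \<Sum>y<Suc k. \<bar>real x - real y\<bar>)
      = (\<Sum>x<k. \<Sum>y<k. \<bar>real x - real y\<bar>) + 2 * (\<Sum>y<k. \<bar>real k - real y\<bar>)"
    by (simp add: sum.distrib abs_minus_commute)
  also have "\<dots> = (real (Suc k) ^ 3 - real (Suc k)) / 3"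
    unfolding Suc sum_abs_diff_last by (simp add: field_simps power3_eq_cube)
  finally show ?case .
qed simp

section \<open>The cycle barbell\<close>

text \<open>In \<open>CB(l + 1, p + 1, b)\<close> the path runs from vertex \<open>p\<close> to vertex \<open>p + l\<close>.\<close>

locale barbell =
  fixes p l b :: nat
  assumes p2: "p \<ge> 2" and l1: "l \<ge> 1" and b3: "b \<ge> 3"
begin

section \<open>Neighbours and degrees in the barbell\<close>

abbreviation adj where "adj \<equiv> cb_adj (l + 1) (p + 1) b"
abbreviation nbrs where "nbrs i \<equiv> {j. j < p + l + b \<and> adj i j}"

text \<open>In this labelling the barbell is one long path through all vertices with two additional
  edges, each closing a cycle. This removes the modular arithmetic from the definition.\<close>

lemma cb_step_iff:
  "cb_step (l + 1) (p + 1) b i j \<longleftrightarrow>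
     i = p \<and> j = 0 \<or> i + 1 < p + l + b \<and> j = i + 1 \<or> i + 1 = p + l + b \<and> j = p + l"
proof -
  have 1: "i < p + 1 \<and> j < p + 1 \<and> j = (i + 1) mod (p + 1) \<longleftrightarrow> i < p \<and> j = i + 1 \<or> i = p \<and> j = 0"
    by (cases "i = p") auto
  have 2: "p + l \<le> i \<and> i < p + l + b \<and> p + l \<le> j \<and> j - (p + l) = (i - (p + l) + 1) mod b \<longleftrightarrow>
      p + l \<le> i \<and> i + 1 < p + l + b \<and> j = i + 1 \<or> i + 1 = p + l + b \<and> j = p + l"
  proof (cases "i + 1 = p + l + b")
    case True
    hence "i - (p + l) + 1 = b" "p + l \<le> i" using b3 by auto
    thus ?thesis using True by auto
  next
    case False
    show ?thesis
    proof (cases "p + l \<le> i \<and> i < p + l + b")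
      case True
      hence "i - (p + l) + 1 < b" using False by linarith
      thus ?thesis using True False by auto
    qed (use False in auto)
  qed
  have 3: "p + 1 + (l + 1) - 2 = p + l" "p + 1 + (l + 1) + b - 2 = p + l + b" "p + 1 - 1 = p" by auto
  show ?thesis unfolding cb_step_def 3 1 2 using b3 by auto
qed

lemma nbrs_eq:
  assumes "i < p + l + b"
  shows "nbrs i =
    (if i = 0 then {1, p} else if i = p then {p - 1, p + 1, 0}
     else if i = p + l then {p + l - 1, p + l + 1, p + l + b - 1}
     else if i + 1 < p + l + b then {i - 1, i + 1} else {p + l + b - 2, p + l})"
proof -
  consider "i = 0" | "i = p" | "i = p + l" | "i + 1 = p + l + b"
    | "i \<noteq> 0" "i \<noteq> p" "i \<noteq> p + l" "i + 1 < p + l + b"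
    using assms by linarith
  thus ?thesis
    unfolding cb_adj_def cb_step_iff using p2 l1 b3 by cases auto
qed

text \<open>The bounds on \<open>p\<close>, \<open>l\<close> and \<open>b\<close> make the listed
  neighbours pairwise distinct, so no summand is lost.\<close>

lemma sum_nbrs:
  fixes f :: "nat \<Rightarrow> real"
  assumes "i < p + l + b"
  shows "(\<Sum>j\<in>nbrs i. f j) =
    (if i = 0 then f 1 + f p else if i = p then f (p - 1) + f (p + 1) + f 0
     else if i = p + l then f (p + l - 1) + f (p + l + 1) + f (p + l + b - 1)
     else if i + 1 < p + l + b then f (i - 1) + f (i + 1) else f (p + l + b - 2) + f (p + l))"
proof -
  have two: "(\<Sum>j\<in>{x, y}. f j) = f x + f y" if "x \<noteq> y" for x y
    using that by simp
  have three: "(\<Sum>j\<in>{x, y, z}. f j) = f x + f y + f z" if "x \<noteq> y" "x \<noteq> z" "y \<noteq> z" for x y z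
    using that by simp
  have "(\<Sum>j\<in>{1, p}. f j) = f 1 + f p"
    using p2 by (intro two) auto
  moreover have "(\<Sum>j\<in>{p - 1, p + 1, 0}. f j) = f (p - 1) + f (p + 1) + f 0"
    using p2 by (intro three) auto
  moreover have "(\<Sum>j\<in>{p + l - 1, p + l + 1, p + l + b - 1}. f j)
      = f (p + l - 1) + f (p + l + 1) + f (p + l + b - 1)"
    using l1 b3 by (intro three) auto
  moreover have "(\<Sum>j\<in>{i - 1, i + 1}. f j) = f (i - 1) + f (i + 1)"
    by (intro two) auto
  moreover have "(\<Sum>j\<in>{p + l + b - 2, p + l}. f j) = f (p + l + b - 2) + f (p + l)"
    using b3 by (intro two) auto
  ultimately show ?thesis unfolding nbrs_eq[OF assms] by (simp only: split: if_split) blast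
qed

lemma deg_eq:
  assumes "i < p + l + b"
  shows "real (deg (p + l + b) adj i) = 2 + (if i = p then 1 else 0) + (if i = p + l then 1 else 0)"
proof -
  have "real (deg (p + l + b) adj i) = (\<Sum>j\<in>nbrs i. 1)" by (simp add: deg_def)
  also have "\<dots> = 2 + (if i = p then 1 else 0) + (if i = p + l then 1 else 0)"
    unfolding sum_nbrs[OF assms] using p2 l1 by auto
  finally show ?thesis .
qed

text \<open>The three blocks meet in cut vertices, so the effective resistance is the sum of the
  resistances between the projections onto the blocks.\<close>

definition proj_a where "proj_a i = min i p"
definition proj_path where "proj_path i = min (i - p) l"
definition proj_b where "proj_b i = i - (p + l)"

definition res :: "nat \<Rightarrow> nat \<Rightarrow> real" where
  "res i j = cycle_res (p + 1) (proj_a i) (proj_a j) + \<bar>real (proj_path i) - real (proj_path j)\<bar>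
    + cycle_res b (proj_b i) (proj_b j)"

text \<open>Taking i = j in the Laplacian condition forces this value: 2 minus the sum of the
  resistances of the edges at \<open>i\<close>. A cycle edge has resistance 1 - 1/m, a path edge
  1.\<close>

definition res_lap :: "nat \<Rightarrow> real" where
  "res_lap i = (if i < p then 2 / (real p + 1) else if i = p then 2 / (real p + 1) - 1
     else if i < p + l then 0 else if i = p + l then 2 / real b - 1 else 2 / real b)"

text \<open>Away from the cut vertices only one of the three summands of \<open>res\<close> changes
  between \<open>i\<close> and its neighbours, and the projection of \<open>j\<close> hits that of
  \<open>i\<close> exactly when i = j. So a single cycle or path identity applies.\<close>

lemma res_laplacian:
  assumes i: "i < p + l + b" and j: "j < p + l + b"
  shows "(\<Sum>s\<in>nbrs i. res i j - res s j) = res_lap i - (if i = j then 2 else 0)"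
proof -
  note projs = proj_a_def proj_path_def proj_b_def
  let ?A = "\<lambda>x. cycle_res (p + 1) x (proj_a j)"
  let ?B = "\<lambda>x. cycle_res b x (proj_b j)"
  let ?P = "\<lambda>x. \<bar>real x - real (proj_path j)\<bar>"
  have ja: "proj_a j < p + 1" and jb: "proj_b j < b" using j b3 by (auto simp: projs)
  consider "i = 0" | "0 < i" "i < p" | "i = p" | "p < i" "i < p + l" | "i = p + l"
    | "p + l < i" "i + 1 < p + l + b" | "i = p + l + b - 1"
    using i by linarith
  thus ?thesis
  proof cases
    case 1
    have "(\<Sum>s\<in>nbrs i. res i j - res s j) = 2 * ?A 0 - ?A 1 - ?A p"
      unfolding sum_nbrs[OF i] using 1 p2 by (simp add: res_def projs)
    thus ?thesis using 1 p2 cycle_res_laplacian_first[OF _ ja]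
      by (auto simp: res_lap_def projs)
  next
    case 2
    have "(\<Sum>s\<in>nbrs i. res i j - res s j) = 2 * ?A i - ?A (i - 1) - ?A (i + 1)"
      unfolding sum_nbrs[OF i] using 2 p2 b3 by (simp add: res_def projs)
    thus ?thesis using 2 cycle_res_laplacian_interior[OF 2(1) _ ja]
      by (auto simp: res_lap_def projs)
  next
    case 3
    \<comment> \<open>At a cut vertex two blocks contribute. The cycle gives 2/m - 2 [j >= p] and
      the end of the path 1 - 2 [j <= p]; the two brackets add up to 1 + [j = p], which leaves 2/m -
      1 - 2 [j = p].\<close>
    have "(\<Sum>s\<in>nbrs i. res i j - res s j) = 2 * ?A p - ?A (p - 1) - ?A 0 + (?P 0 - ?P 1)"
      unfolding sum_nbrs[OF i] using 3 p2 l1 by (simp add: res_def projs)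
    thus ?thesis using 3 p2 l1 cycle_res_laplacian_last[OF _ ja]
      by (auto simp: res_lap_def projs)
  next
    case 4
    have at: "proj_a i = p" "proj_path i = i - p" "proj_b i = 0"
      "proj_a (i - 1) = p" "proj_path (i - 1) = i - p - 1" "proj_b (i - 1) = 0"
      "proj_a (i + 1) = p" "proj_path (i + 1) = i - p + 1" "proj_b (i + 1) = 0"
      using 4 by (auto simp: projs)
    have "(\<Sum>s\<in>nbrs i. res i j - res s j) = 2 * ?P (i - p) - ?P (i - p - 1) - ?P (i - p + 1)"
      unfolding sum_nbrs[OF i] using 4 b3 by (simp add: res_def at del: One_nat_def)
    also have "\<dots> = - (if i - p = proj_path j then 2 else 0)"
      using 4 by (intro path_res_laplacian_interior) simp
    also have "i - p = proj_path j \<longleftrightarrow> i = j" using 4 by (auto simp: projs)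
    finally show ?thesis using 4 by (simp add: res_lap_def)
  next
    case 5
    have at: "proj_a (p + l) = p" "proj_path (p + l) = l" "proj_b (p + l) = 0"
      "proj_a (p + l - 1) = p" "proj_path (p + l - 1) = l - 1" "proj_b (p + l - 1) = 0"
      "proj_a (p + l + 1) = p" "proj_path (p + l + 1) = l" "proj_b (p + l + 1) = 1"
      "proj_a (p + l + b - 1) = p" "proj_path (p + l + b - 1) = l" "proj_b (p + l + b - 1) = b - 1"
      using l1 b3 by (auto simp: projs)
    have "(\<Sum>s\<in>nbrs i. res i j - res s j) = 2 * ?B 0 - ?B 1 - ?B (b - 1) + (?P l - ?P (l - 1))"
      unfolding sum_nbrs[OF i] using 5 l1 p2 by (simp add: res_def at del: One_nat_def)
    also have "2 * ?B 0 - ?B 1 - ?B (b - 1) = 2 / real b - (if proj_b j = 0 then 2 else 0)"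
      using b3 by (intro cycle_res_laplacian_first jb) auto
    also have "?P l - ?P (l - 1) = (if proj_path j = l then - 1 else 1)"
      using l1 by (auto simp: proj_path_def of_nat_diff)
    also have "proj_path j = l \<longleftrightarrow> p + l \<le> j" using l1 by (auto simp: projs)
    also have "proj_b j = 0 \<longleftrightarrow> j \<le> p + l" by (auto simp: projs)
    finally show ?thesis using 5 l1 by (simp add: res_lap_def)
  next
    case 6
    let ?x = "i - (p + l)"
    have at: "proj_a i = p" "proj_path i = l" "proj_b i = ?x"
      "proj_a (i - 1) = p" "proj_path (i - 1) = l" "proj_b (i - 1) = ?x - 1"
      "proj_a (i + 1) = p" "proj_path (i + 1) = l" "proj_b (i + 1) = ?x + 1"
      using 6 by (auto simp: projs)
    have "(\<Sum>s\<in>nbrs i. res i j - res s j) = 2 * ?B ?x - ?B (?x - 1) - ?B (?x + 1)"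
      unfolding sum_nbrs[OF i] using 6 by (simp add: res_def at del: One_nat_def)
    also have "\<dots> = 2 / real b - (if ?x = proj_b j then 2 else 0)"
      using 6 by (intro cycle_res_laplacian_interior jb) auto
    also have "?x = proj_b j \<longleftrightarrow> i = j" using 6 by (auto simp: projs)
    finally show ?thesis using 6 by (simp add: res_lap_def)
  next
    case 7
    have at: "proj_a (p + l) = p" "proj_path (p + l) = l" "proj_b (p + l) = 0"
      "proj_a (p + l + b - 1) = p" "proj_path (p + l + b - 1) = l" "proj_b (p + l + b - 1) = b - 1"
      "proj_a (p + l + b - 2) = p" "proj_path (p + l + b - 2) = l" "proj_b (p + l + b - 2) = b - 2"
      using b3 by (auto simp: projs)
    have "i \<noteq> 0" "i \<noteq> p" "i \<noteq> p + l" "\<not> i + 1 < p + l + b" using 7 b3 l1 by auto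
    hence "(\<Sum>s\<in>nbrs i. res i j - res s j) = 2 * ?B (b - 1) - ?B (b - 2) - ?B 0"
      unfolding sum_nbrs[OF i] using 7 by (simp add: res_def at del: One_nat_def)
    also have "\<dots> = 2 / real b - (if proj_b j = b - 1 then 2 else 0)"
      using b3 by (intro cycle_res_laplacian_last jb) auto
    also have "proj_b j = b - 1 \<longleftrightarrow> i = j" using 7 j b3 by (auto simp: projs)
    also have "2 / real b = res_lap i" using 7 b3 by (auto simp: res_lap_def)
    finally show ?thesis .
  qed
qed

section \<open>Degree-weighted double sums of resistances\<close>

abbreviation dg where "dg \<equiv> \<lambda>i. real (deg (p + l + b) adj i)"

text \<open>All degrees are 2 except 3 at the two cut vertices. These are split off so that on each
  remaining range two of the three projections are constant.\<close>

lemma sum_dg: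
  "(\<Sum>i<p + l + b. dg i * f i) = 2 * (\<Sum>i<p. f i) + 3 * f p + 2 * (\<Sum>x<l - 1. f (p + 1 + x))
     + 3 * f (p + l) + 2 * (\<Sum>x<b - 1. f (p + l + 1 + x))"
proof -
  have shift: "(\<Sum>i<m + d. g i) = (\<Sum>i<m. g i) + (\<Sum>x<d. g (m + x))" for m d :: nat and g :: "nat \<Rightarrow> real"
    by (induction d) (auto simp: add.assoc)
  have "(\<Sum>i<p + l + b. dg i * f i)
      = (\<Sum>i<p + l + b. 2 * f i + (if i = p then f i else 0) + (if i = p + l then f i else 0))"
    by (intro sum.cong refl, subst deg_eq) (simp_all add: algebra_simps)
  also have "\<dots> = 2 * (\<Sum>i<p + l + b. f i) + f p + f (p + l)"
    using b3 by (simp add: sum.distrib sum_distrib_left)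
  also have "(\<Sum>i<p + l + b. f i) = (\<Sum>i<p. f i) + (\<Sum>x<Suc (l - 1). f (p + x)) + (\<Sum>x<Suc (b - 1). f (p + l + x))"
    using l1 b3 by (simp only: shift) simp
  finally show ?thesis by (simp only: sum.lessThan_Suc_shift) (simp add: algebra_simps)
qed

text \<open>This is the degree measure pushed forward to the first cycle: weight 2 on every vertex,
  and the rest of the graph collapses to the point \<open>p\<close>, adding the mass 2 (l +
  b).\<close>

lemma sum_dg_proj_a:
  "(\<Sum>i<p + l + b. dg i * f (proj_a i)) = 2 * (\<Sum>x<p + 1. f x) + 2 * (real l + real b) * f p"
  unfolding sum_dg using l1 b3 by (simp add: proj_a_def of_nat_diff algebra_simps)

text \<open>Each cycle collapses to an end of the path. The total degrees of the cycle vertices are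
  2p + 3 and 2b + 1; removing the uniform weight 2 at the end leaves 2p + 1 and 2b - 1.\<close>

lemma sum_dg_proj_path:
  "(\<Sum>i<p + l + b. dg i * f (proj_path i))
     = 2 * (\<Sum>x<l + 1. f x) + (2 * real p + 1) * f 0 + (2 * real b - 1) * f l"
proof -
  have "(\<Sum>x<l + 1. f x) = f 0 + (\<Sum>x<l - 1. f (1 + x)) + f l"
  proof -
    obtain m where "l = Suc m" using l1 by (cases l) auto
    thus ?thesis using sum.lessThan_Suc_shift[of f "Suc m"] by simp
  qed
  moreover have "(\<Sum>x<l - 1. f (proj_path (p + 1 + x))) = (\<Sum>x<l - 1. f (1 + x))"
    by (intro sum.cong) (auto simp: proj_path_def)
  ultimately show ?thesis
    unfolding sum_dg using l1 b3 by (simp add: proj_path_def of_nat_diff algebra_simps)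
qed

lemma sum_dg_proj_b:
  "(\<Sum>i<p + l + b. dg i * f (proj_b i)) = 2 * (\<Sum>x<b. f x) + 2 * (real p + real l + 1) * f 0"
proof -
  have "(\<Sum>x<b. f x) = f 0 + (\<Sum>x<b - 1. f (1 + x))"
    using sum.lessThan_Suc_shift[of f "b - 1"] b3 by simp
  moreover have "(\<Sum>x<l - 1. f (proj_b (p + 1 + x))) = (real l - 1) * f 0"
    using l1 by (simp add: proj_b_def of_nat_diff)
  ultimately show ?thesis
    unfolding sum_dg using l1 b3 by (simp add: proj_b_def of_nat_diff algebra_simps)
qed


text \<open>The push-forward is applied to both variables. Resistance sums on a cycle have the same
  value \<open>S\<close> from every vertex, and the collapsed mass at \<open>p\<close> has
  resistance 0 to itself, so only terms linear in \<open>S\<close> survive.\<close>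

lemma sum_dg_res_a:
  "(\<Sum>i<p + l + b. dg i * (\<Sum>j<p + l + b. dg j * cycle_res (p + 1) (proj_a i) (proj_a j)))
    = 2 / 3 * ((real p + 1)\<^sup>2 - 1) * (real p + 1 + 2 * (real l + real b))"
proof -
  define S where "S = ((real p + 1)\<^sup>2 - 1) / 6"
  have S: "(\<Sum>y<p + 1. cycle_res (p + 1) x y) = S" if "x < p + 1" for x
    using sum_cycle_res[OF that] by (simp add: S_def add.commute)
  have S': "(\<Sum>x<p + 1. cycle_res (p + 1) x p) = S"
    using S[of p] by (simp add: cycle_res_commute[of _ _ p])
  have "(\<Sum>i<p + l + b. dg i * (\<Sum>j<p + l + b. dg j * cycle_res (p + 1) (proj_a i) (proj_a j)))
      = (\<Sum>i<p + l + b. dg i * (2 * S + 2 * (real l + real b) * cycle_res (p + 1) (proj_a i) p))"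
    unfolding sum_dg_proj_a by (intro sum.cong refl, subst S) (auto simp: proj_a_def)
  also have "\<dots> = 2 * (\<Sum>x<p + 1. 2 * S + 2 * (real l + real b) * cycle_res (p + 1) x p)
      + 2 * (real l + real b) * (2 * S + 2 * (real l + real b) * cycle_res (p + 1) p p)"
    by (rule sum_dg_proj_a)
  also have "(\<Sum>x<p + 1. 2 * S + 2 * (real l + real b) * cycle_res (p + 1) x p)
      = 2 * (real p + 1) * S + 2 * (real l + real b) * S"
    unfolding sum.distrib sum_distrib_left[symmetric] S' by simp
  also have "2 * (2 * (real p + 1) * S + 2 * (real l + real b) * S)
      + 2 * (real l + real b) * (2 * S + 2 * (real l + real b) * cycle_res (p + 1) p p)
      = 4 * S * (real p + 1 + 2 * (real l + real b))"
    by (simp add: algebra_simps)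
  also have "4 * S = 2 / 3 * ((real p + 1)\<^sup>2 - 1)" by (simp add: S_def)
  finally show ?thesis .
qed

lemma sum_dg_res_b:
  "(\<Sum>i<p + l + b. dg i * (\<Sum>j<p + l + b. dg j * cycle_res b (proj_b i) (proj_b j)))
    = 2 / 3 * ((real b)\<^sup>2 - 1) * (real b + 2 * (real p + real l + 1))"
proof -
  define S where "S = ((real b)\<^sup>2 - 1) / 6"
  have S: "(\<Sum>y<b. cycle_res b x y) = S" if "x < b" for x
    using sum_cycle_res[OF that] by (simp add: S_def)
  have S': "(\<Sum>x<b. cycle_res b x 0) = S"
    using S[of 0] b3 by (simp add: cycle_res_commute[of _ _ 0])
  have "(\<Sum>i<p + l + b. dg i * (\<Sum>j<p + l + b. dg j * cycle_res b (proj_b i) (proj_b j)))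
      = (\<Sum>i<p + l + b. dg i * (2 * S + 2 * (real p + real l + 1) * cycle_res b (proj_b i) 0))"
    unfolding sum_dg_proj_b using b3 by (intro sum.cong refl, subst S) (auto simp: proj_b_def)
  also have "\<dots> = 2 * (\<Sum>x<b. 2 * S + 2 * (real p + real l + 1) * cycle_res b x 0)
      + 2 * (real p + real l + 1) * (2 * S + 2 * (real p + real l + 1) * cycle_res b 0 0)"
    by (rule sum_dg_proj_b)
  also have "(\<Sum>x<b. 2 * S + 2 * (real p + real l + 1) * cycle_res b x 0)
      = 2 * real b * S + 2 * (real p + real l + 1) * S"
    unfolding sum.distrib sum_distrib_left[symmetric] S' by simp
  also have "2 * (2 * real b * S + 2 * (real p + real l + 1) * S)
      + 2 * (real p + real l + 1) * (2 * S + 2 * (real p + real l + 1) * cycle_res b 0 0)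
      = 4 * S * (real b + 2 * (real p + real l + 1))"
    by (simp add: algebra_simps)
  also have "4 * S = 2 / 3 * ((real b)\<^sup>2 - 1)" by (simp add: S_def)
  finally show ?thesis .
qed

lemma sum_dg_res_path:
  "(\<Sum>i<p + l + b. dg i * (\<Sum>j<p + l + b. dg j * \<bar>real (proj_path i) - real (proj_path j)\<bar>))
    = 8 * (real p + 1) * real b * real l + 4 * (real p + 1 + real b) * (real l)\<^sup>2
      + 2 / 3 * real l * (2 * (real l)\<^sup>2 + 1)"
proof -
  define P where "P = 2 * real p + 1"
  define B where "B = 2 * real b - 1"
  \<comment> \<open>The weighted sum of distances seen from the point \<open>x\<close> of the path,
    where \<open>P\<close> and \<open>B\<close> are the masses of the collapsed cycles at its
    ends.\<close>
  define h where "h x = 2 * (\<Sum>y<l + 1. \<bar>real x - real y\<bar>) + P * \<bar>real x - real 0\<bar> + B * \<bar>real x - real l\<bar>" for x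
  have l_sum: "(\<Sum>y<l + 1. \<bar>real l - real y\<bar>) = real l * (real l + 1) / 2"
    using sum_abs_diff_last[of l] by simp
  have l_sum': "(\<Sum>y<l + 1. \<bar>real y - real l\<bar>) = real l * (real l + 1) / 2"
    using l_sum by (simp add: abs_minus_commute)
  have zero_sum: "(\<Sum>y<l + 1. \<bar>real 0 - real y\<bar>) = real l * (real l + 1) / 2"
    by (induction l) (auto simp: field_simps)
  have zero_sum': "(\<Sum>y<l + 1. \<bar>real y - real 0\<bar>) = real l * (real l + 1) / 2"
    using zero_sum by simp
  have h_sum: "(\<Sum>x<l + 1. h x) = 2 * (((real l + 1) ^ 3 - (real l + 1)) / 3)
      + P * (real l * (real l + 1) / 2) + B * (real l * (real l + 1) / 2)"
    unfolding h_def sum.distrib sum_distrib_left[symmetric] sum_sum_abs_diff zero_sum' l_sum'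
    by (simp add: add.commute)
  have h_0: "h 0 = real l * (real l + 1) + B * real l"
    unfolding h_def zero_sum by simp
  have h_l: "h l = real l * (real l + 1) + P * real l"
    unfolding h_def l_sum by simp
  have "(\<Sum>j<p + l + b. dg j * \<bar>real x - real (proj_path j)\<bar>) = h x" for x
    unfolding h_def P_def B_def by (rule sum_dg_proj_path)
  hence "(\<Sum>i<p + l + b. dg i * (\<Sum>j<p + l + b. dg j * \<bar>real (proj_path i) - real (proj_path j)\<bar>))
      = (\<Sum>i<p + l + b. dg i * h (proj_path i))"
    by simp
  also have "\<dots> = 2 * (\<Sum>x<l + 1. h x) + P * h 0 + B * h l"
    unfolding P_def B_def by (rule sum_dg_proj_path)
  finally show ?thesis unfolding h_sum h_0 h_l
    by (simp add: P_def B_def field_simps power2_eq_square power3_eq_cube)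
qed

section \<open>The closed formula\<close>

theorem vertex_kemeny_barbell:
  "vertex_kemeny (p + l + b) adj = complex_of_real
    ((2 / 3 * ((real p + 1)\<^sup>2 - 1) * (real p + 1 + 2 * (real l + real b))
      + (8 * (real p + 1) * real b * real l + 4 * (real p + 1 + real b) * (real l)\<^sup>2
         + 2 / 3 * real l * (2 * (real l)\<^sup>2 + 1))
      + 2 / 3 * ((real b)\<^sup>2 - 1) * (real b + 2 * (real p + real l + 1)))
     / (4 * (real p + real l + real b + 1)))"
proof -
  \<comment> \<open>The degrees add up to twice the number p + l + b + 1 of edges, which gives the
    denominator.\<close>
  have "(\<Sum>i<p + l + b. dg i) = 2 * (real p + real l + real b + 1)"
    using sum_dg[of "\<lambda>_. 1"] l1 b3 by (simp add: of_nat_diff)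
  moreover have "(\<Sum>i<p + l + b. dg i * (\<Sum>j<p + l + b. dg j * res i j))
    = 2 / 3 * ((real p + 1)\<^sup>2 - 1) * (real p + 1 + 2 * (real l + real b))
      + (8 * (real p + 1) * real b * real l + 4 * (real p + 1 + real b) * (real l)\<^sup>2
         + 2 / 3 * real l * (2 * (real l)\<^sup>2 + 1))
      + 2 / 3 * ((real b)\<^sup>2 - 1) * (real b + 2 * (real p + real l + 1))"
    unfolding res_def distrib_left sum.distrib sum_dg_res_a sum_dg_res_path sum_dg_res_b ..
  moreover have "0 < deg (p + l + b) adj i" if "i < p + l + b" for i
    using deg_eq[OF that] by (cases "deg (p + l + b) adj i") (auto split: if_splits)
  ultimately show ?thesis
    using vertex_kemeny_eq_resistance_sum[of "p + l + b" adj res res_lap] res_laplacian b3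
    by (simp add: cb_adj_def disj_commute res_def)
qed

end

theorem theorem5p2:
  fixes a b k :: nat
  assumes "a \<ge> 3" and "b \<ge> 3" and "k \<ge> 2"
  shows "vertex_kemeny (cb_nverts k a b) (cb_adj k a b) =
    complex_of_real
     ((1 / (real a + real b + real k - 1)) *
      ((real a + 1) * (real a - 1) / 6 * (real a + 2 * (real b + real k - 1))
     + (real b + 1) * (real b - 1) / 6 * (real b + 2 * (real a + real k - 1))
     + (real a + real b) * (real k - 1) ^ 2
     + (real k - 1) * (2 * (real k)^2 - 4 * real k + 3) / 6
     + 2 * real a * real b * (real k - 1)))"
proof -
  \<comment> \<open>The numbers a - 1 and k - 1 replace \<open>a\<close> and \<open>k\<close>, which
    avoids truncated subtraction in the vertex labels.\<close>
  obtain p l where pl: "a = p + 1" "k = l + 1"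
    using assms by (metis add.commute le_add_diff_inverse le_trans one_le_numeral)
  interpret barbell p l b using assms pl by unfold_locales auto
  have n: "cb_nverts k a b = p + l + b" by (simp add: cb_nverts_def pl)
  \<comment> \<open>This is the common denominator a + b + k - 1; its positivity lets both formulas
    be cleared of fractions.\<close>
  have "real p + real l + real b + 1 > 0" by linarith
  thus ?thesis
    unfolding n unfolding pl vertex_kemeny_barbell
    by (intro arg_cong[of _ _ complex_of_real]) (simp add: field_simps power2_eq_square power3_eq_cube)
qed

end
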